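(* Let $p\geq 2$ and let $G$ be a finite simple $\{pK_2, \mathrm{gem}\}$-free graph. Then $\chi(G)\leq f_p(\omega(G))$, where the functions $f_p:\mathbb{N}\to\mathbb{N}$ ($p\geq 2$) are defined by: $f_t(1)=1$ for all $t\geq 2$; $f_2(2)=3$; $f_2(m)=m$ for $m\geq 3$; $f_p(2)=2p-2$ for $p\geq 3$; and $f_p(m)=f_{p-1}(m)+2m-2$ for $p,m\geq 3$.
   Context: $\chi(G)$ is the chromatic number and $\omega(G)$ the clique number of $G$. $pK_2$ is the disjoint union of $p$ edges. The gem is the graph obtained from the path $P_4$ on four vertices by adding a vertex adjacent to all four of its vertices (i.e. $K_1+P_4$). A graph is $\mathcal{F}$-free if it has no induced subgraph isomorphic to a member of $\mathcal{F}$. *)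

theory Defs
  imports "Graph_Theory.Pair_Digraph" "Graph_Theory.Digraph_Isomorphism"
begin

text \<open>
  A finite simple graph is a \<^locale>\<open>pair_graph\<close>: a finite vertex set with a symmetric
  irreflexive relation on it, so that each edge $uv$ is the pair of arcs $(u,v)$, $(v,u)$.
\<close>

definition proper_colouring :: "'a pair_pre_digraph \<Rightarrow> nat \<Rightarrow> ('a \<Rightarrow> nat) \<Rightarrow> bool" where
  "proper_colouring G k c \<longleftrightarrow>
     c ` pverts G \<subseteq> {..<k} \<and> (\<forall>(u, v) \<in> parcs G. c u \<noteq> c v)"

definition chromatic_number :: "'a pair_pre_digraph \<Rightarrow> nat" where
  "chromatic_number G = (LEAST k. \<exists>c. proper_colouring G k c)"

definition clique :: "'a pair_pre_digraph \<Rightarrow> 'a set \<Rightarrow> bool" where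
  "clique G S \<longleftrightarrow> S \<subseteq> pverts G \<and> pairwise (\<lambda>u v. (u, v) \<in> parcs G) S"

definition clique_number :: "'a pair_pre_digraph \<Rightarrow> nat" where
  "clique_number G = Max (card ` {S. clique G S})"

definition family_free :: "'b pair_pre_digraph set \<Rightarrow> 'a pair_pre_digraph \<Rightarrow> bool" where
  "family_free \<F> G \<longleftrightarrow>
     \<not> (\<exists>F \<in> \<F>. \<exists>H. induced_subgraph H (with_proj G) \<and> digraph_iso H (with_proj F))"

definition pK2 :: "nat \<Rightarrow> nat pair_pre_digraph" where
  "pK2 p = \<lparr> pverts = {..<2 * p},
             parcs = (\<Union>i<p. {(2 * i, 2 * i + 1), (2 * i + 1, 2 * i)}) \<rparr>"

text \<open>The path is $0,1,2,3$; the vertex adjacent to all of it is $4$.\<close>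

definition gem :: "nat pair_pre_digraph" where
  "gem = (let E = {(0, 1), (1, 2), (2, 3), (4, 0), (4, 1), (4, 2), (4, 3)}
          in \<lparr> pverts = {..<5}, parcs = E \<union> E\<inverse> \<rparr>)"

text \<open>
  The functions $f_p$ are only meaningful for $p \ge 2$; below that the value is that of $f_2$.
  The value $0$ at $m = 0$ serves the graph without vertices, whose clique number is $0$.
\<close>

fun gem_bound :: "nat \<Rightarrow> nat \<Rightarrow> nat" where
  "gem_bound p m =
     (if m = 0 then 0
      else if m = 1 then 1
      else if p \<le> 2 then (if m = 2 then 3 else m)
      else if m = 2 then 2 * p - 2
      else gem_bound (p - 1) m + 2 * m - 2)"

declare gem_bound.simps [simp del]

lemma gem_bound_eqs:
  "gem_bound p 1 = 1"
  "gem_bound 2 2 = 3"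
  "m \<ge> 3 \<Longrightarrow> gem_bound 2 m = m"
  "p \<ge> 3 \<Longrightarrow> gem_bound p 2 = 2 * p - 2"
  "p \<ge> 3 \<Longrightarrow> m \<ge> 3 \<Longrightarrow> gem_bound p m = gem_bound (p - 1) m + 2 * m - 2"
  by (subst gem_bound.simps; simp)+

lemma pair_graph_pK2: "pair_graph (pK2 p)"
  by unfold_locales
    (auto simp: pK2_def with_proj_def symmetric_def arcs_ends_def arc_to_ends_def sym_def)

lemma pair_graph_gem: "pair_graph gem"
  by unfold_locales
    (auto simp: gem_def Let_def with_proj_def symmetric_def arcs_ends_def arc_to_ends_def sym_def)

end

theory Submission
  imports Defs "HOL-Library.Numeral_Type"
begin

text \<open>
  The bound is proved by induction on \<open>p\<close>. For an edge \<open>uv\<close>, the neighbourhoods of \<open>u\<close> and \<open>v\<close> are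
  $P_4$-free by gem-freeness, hence coloured with $\omega - 1$ colours each, and the
  remaining vertices contain no $(p-1)K_2$. The induction starts at two places.

  For \<open>p = 2\<close> and a maximum clique \<open>K\<close> with at least three vertices, each vertex is coloured by a
  non-neighbour in \<open>K\<close>; adjacent vertices share at most one non-neighbour in \<open>K\<close>, and
  gem-freeness makes such clashes rare enough to be avoided.

  For \<open>p = 3\<close> and $\omega = 2$, one colour has to be saved. The vertices that see neither end of an
  edge \<open>uv\<close> induce a bipartite graph or a blown-up five-cycle with isolated vertices. In the latter
  case the blown-up cycle and the neighbours of \<open>v\<close> map to a five-cycle, so three colours suffice
  for them and the neighbours of \<open>u\<close> get the fourth. Extending this to the isolated vertices can
  only fail for all five rotations of the colouring if an induced $3K_2$ appears.
\<close>

section \<open>Colourings, cliques and induced matchings\<close>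

definition stable_set :: "('a \<Rightarrow> 'a \<Rightarrow> bool) \<Rightarrow> 'a set \<Rightarrow> bool" where
  "stable_set E S \<longleftrightarrow> (\<forall>x\<in>S. \<forall>y\<in>S. \<not> E x y)"

definition colourable :: "('a \<Rightarrow> 'a \<Rightarrow> bool) \<Rightarrow> 'a set \<Rightarrow> nat \<Rightarrow> bool" where
  "colourable E S k \<longleftrightarrow> (\<exists>c. c ` S \<subseteq> {..<k} \<and> (\<forall>x\<in>S. \<forall>y\<in>S. E x y \<longrightarrow> c x \<noteq> c y))"

definition cliques_le :: "('a \<Rightarrow> 'a \<Rightarrow> bool) \<Rightarrow> 'a set \<Rightarrow> nat \<Rightarrow> bool" where
  "cliques_le E S m \<longleftrightarrow> (\<forall>K. K \<subseteq> S \<longrightarrow> pairwise E K \<longrightarrow> card K \<le> m)"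

definition path4_free :: "('a \<Rightarrow> 'a \<Rightarrow> bool) \<Rightarrow> 'a set \<Rightarrow> bool" where
  "path4_free E S \<longleftrightarrow> \<not> (\<exists>a\<in>S. \<exists>b\<in>S. \<exists>c\<in>S. \<exists>d\<in>S.
     E a b \<and> E b c \<and> E c d \<and> \<not> E a c \<and> \<not> E a d \<and> \<not> E b d)"

definition gem_free :: "('a \<Rightarrow> 'a \<Rightarrow> bool) \<Rightarrow> 'a set \<Rightarrow> bool" where
  "gem_free E S \<longleftrightarrow> (\<forall>e\<in>S. path4_free E {x \<in> S. E e x})"

text \<open>Two edges that share an end are linked as well.\<close>

definition linked :: "('a \<Rightarrow> 'a \<Rightarrow> bool) \<Rightarrow> 'a \<Rightarrow> 'a \<Rightarrow> 'a \<Rightarrow> 'a \<Rightarrow> bool" where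
  "linked E a b c d \<longleftrightarrow> E a c \<or> E a d \<or> E b c \<or> E b d"

definition matching_free :: "('a \<Rightarrow> 'a \<Rightarrow> bool) \<Rightarrow> 'a set \<Rightarrow> nat \<Rightarrow> bool" where
  "matching_free E S p \<longleftrightarrow> \<not> (\<exists>f g. (\<forall>i<p. f i \<in> S \<and> g i \<in> S \<and> E (f i) (g i)) \<and>
     (\<forall>i<p. \<forall>j<p. i \<noteq> j \<longrightarrow> \<not> linked E (f i) (g i) (f j) (g j)))"

definition far_from :: "('a \<Rightarrow> 'a \<Rightarrow> bool) \<Rightarrow> 'a \<Rightarrow> 'a \<Rightarrow> 'a \<Rightarrow> bool" where
  "far_from E u v w \<longleftrightarrow> \<not> E u w \<and> \<not> E v w"

lemma stable_setI: "(\<And>x y. x \<in> S \<Longrightarrow> y \<in> S \<Longrightarrow> \<not> E x y) \<Longrightarrow> stable_set E S"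
  by (simp add: stable_set_def)

lemma stable_set_union:
  assumes "stable_set E S" "stable_set E T" "\<And>x y. x \<in> S \<Longrightarrow> y \<in> T \<Longrightarrow> \<not> E x y \<and> \<not> E y x"
  shows "stable_set E (S \<union> T)"
  using assms unfolding stable_set_def by blast

lemma colourableI:
  assumes "finite P" "\<And>x. x \<in> S \<Longrightarrow> c x \<in> P"
    and "\<And>x y. x \<in> S \<Longrightarrow> y \<in> S \<Longrightarrow> E x y \<Longrightarrow> c x \<noteq> c y"
  shows "colourable E S (card P)"
proof -
  obtain h where h: "bij_betw h P {..<card P}"
    using ex_bij_betw_finite_nat[OF assms(1)] by (auto simp: atLeast0LessThan)
  show ?thesis
    unfolding colourable_def
    by (rule exI[of _ "h \<circ> c"]) (use h assms(2,3) in \<open>auto simp: bij_betw_def inj_on_eq_iff\<close>)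
qed

lemma colourable_stable_set: "stable_set E S \<Longrightarrow> colourable E S 1"
  unfolding colourable_def stable_set_def by (rule exI[of _ "\<lambda>_. 0"]) auto

lemma colourable_mono: "colourable E S k \<Longrightarrow> k \<le> l \<Longrightarrow> colourable E S l"
  unfolding colourable_def by (meson lessThan_subset_iff order_trans)

lemma colourable_subset: "colourable E S k \<Longrightarrow> T \<subseteq> S \<Longrightarrow> colourable E T k"
  unfolding colourable_def by (meson image_mono order_trans subsetD)

lemma colourable_union:
  assumes "colourable E S k" "colourable E T l"
  shows "colourable E (S \<union> T) (k + l)"
proof -
  obtain c where c: "c ` S \<subseteq> {..<k}" "\<forall>x\<in>S. \<forall>y\<in>S. E x y \<longrightarrow> c x \<noteq> c y"
    using assms(1) unfolding colourable_def by (elim exE conjE)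
  obtain d where d: "d ` T \<subseteq> {..<l}" "\<forall>x\<in>T. \<forall>y\<in>T. E x y \<longrightarrow> d x \<noteq> d y"
    using assms(2) unfolding colourable_def by (elim exE conjE)
  define e where "e x = (if x \<in> S then c x else k + d x)" for x
  have "e x \<noteq> e y" if "x \<in> S \<union> T" "y \<in> S \<union> T" "E x y" for x y
  proof -
    have "c z \<noteq> k + n" if "z \<in> S" for z n using c(1) that by fastforce
    then show ?thesis using c(2) d(2) that unfolding e_def by (metis UnE add_left_cancel)
  qed
  moreover have "e ` (S \<union> T) \<subseteq> {..<k + l}"
    using c(1) d(1) by (auto simp: e_def image_subset_iff trans_less_add1)
  ultimately show ?thesis unfolding colourable_def by blast
qed

lemma colourable_restrict:
  "colourable (\<lambda>x y. x \<in> S \<and> y \<in> S \<and> E x y) T k \<Longrightarrow> T \<subseteq> S \<Longrightarrow> colourable E T k"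
  unfolding colourable_def by (meson subsetD)

lemma cliques_leD: "cliques_le E S m \<Longrightarrow> K \<subseteq> S \<Longrightarrow> pairwise E K \<Longrightarrow> card K \<le> m"
  by (simp add: cliques_le_def)

lemma cliques_le_mono: "cliques_le E S l \<Longrightarrow> l \<le> m \<Longrightarrow> cliques_le E S m"
  unfolding cliques_le_def by (meson order_trans)

lemma cliques_le_subset: "cliques_le E S m \<Longrightarrow> T \<subseteq> S \<Longrightarrow> cliques_le E T m"
  unfolding cliques_le_def by blast

lemma gem_free_subset: "gem_free E S \<Longrightarrow> T \<subseteq> S \<Longrightarrow> gem_free E T"
  unfolding gem_free_def path4_free_def by blast

lemma not_matching_free_0: "\<not> matching_free E S 0"
  by (simp add: matching_free_def)

lemma matching_free_restrict:
  assumes "matching_free E S p"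
  shows "matching_free (\<lambda>x y. x \<in> S \<and> y \<in> S \<and> E x y) UNIV p"
  unfolding matching_free_def
proof clarify
  fix f g :: "nat \<Rightarrow> 'a"
  assume edges: "\<forall>i<p. f i \<in> UNIV \<and> g i \<in> UNIV \<and> f i \<in> S \<and> g i \<in> S \<and> E (f i) (g i)"
    and "\<forall>i<p. \<forall>j<p. i \<noteq> j \<longrightarrow>
      \<not> linked (\<lambda>x y. x \<in> S \<and> y \<in> S \<and> E x y) (f i) (g i) (f j) (g j)"
  then have "\<forall>i<p. \<forall>j<p. i \<noteq> j \<longrightarrow> \<not> linked E (f i) (g i) (f j) (g j)"
    by (simp add: linked_def)
  then show False using assms edges unfolding matching_free_def by blast
qed

locale adjacency =
  fixes E :: "'a \<Rightarrow> 'a \<Rightarrow> bool"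
  assumes sym: "E x y \<Longrightarrow> E y x" and irrefl: "\<not> E x x"
begin

lemma commute: "E x y \<longleftrightarrow> E y x"
  using sym by blast

lemma card_extendable_clique_less:
  assumes "finite S" "cliques_le E S m" "K \<subseteq> S" "pairwise E K" "x \<in> S" "\<And>k. k \<in> K \<Longrightarrow> E x k"
  shows "card K < m"
proof -
  have "x \<notin> K" using assms(6) irrefl by blast
  moreover have "finite K" using assms(1,3) finite_subset by blast
  moreover have "pairwise E (insert x K)" using assms(4,6) sym by (auto simp: pairwise_insert)
  then have "card (insert x K) \<le> m" using cliques_leD assms(2,3,5) by blast
  ultimately show ?thesis by simp
qed

lemma ex_maximum_clique:
  assumes "finite S"
  shows "\<exists>K\<subseteq>S. pairwise E K \<and> cliques_le E S (card K)"
proof -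
  let ?C = "{K. K \<subseteq> S \<and> pairwise E K}"
  have fin: "finite ?C" using assms by simp
  have "{} \<in> ?C" by simp
  then have "?C \<noteq> {}" by blast
  then obtain K where K: "K \<in> ?C" "card K = Max (card ` ?C)"
    using obtains_MAX[OF fin] by metis
  then have "cliques_le E S (card K)"
    unfolding cliques_le_def using Max_ge[OF finite_imageI[OF fin], of _ card] by simp
  then show ?thesis using K(1) by blast
qed

lemma stable_set_if_cliques_le_1:
  assumes "cliques_le E S 1"
  shows "stable_set E S"
proof (rule stable_setI)
  fix x y assume xy: "x \<in> S" "y \<in> S"
  show "\<not> E x y"
  proof
    assume "E x y"
    then have "x \<noteq> y" "pairwise E {x, y}" using sym irrefl by (auto simp: pairwise_insert)
    then show False using cliques_leD[OF assms, of "{x, y}"] xy by simp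
  qed
qed

lemma triangle_free_if_cliques_le_2:
  assumes "cliques_le E S 2" "x \<in> S" "y \<in> S" "z \<in> S" "E x y" "E y z"
  shows "\<not> E x z"
proof
  assume "E x z"
  then have "pairwise E {x, y, z}" "card {x, y, z} = 3"
    using assms(5,6) sym irrefl by (auto simp: pairwise_def card_insert_if dest: sym)
  then show False using cliques_leD[OF assms(1), of "{x, y, z}"] assms(2-4) by simp
qed

lemma gem_free_if_cliques_le_2: "cliques_le E S 2 \<Longrightarrow> gem_free E S"
  using triangle_free_if_cliques_le_2 unfolding gem_free_def path4_free_def by blast

lemma matching_free_far:
  assumes "matching_free E S (Suc p)" "u \<in> S" "v \<in> S" "E u v"
  shows "matching_free E {w \<in> S. far_from E u v w} p"
  unfolding matching_free_def
proof clarify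
  fix f g
  assume edges: "\<forall>i<p. f i \<in> {w \<in> S. far_from E u v w} \<and> g i \<in> {w \<in> S. far_from E u v w} \<and>
    E (f i) (g i)"
    and unlinked: "\<forall>i<p. \<forall>j<p. i \<noteq> j \<longrightarrow> \<not> linked E (f i) (g i) (f j) (g j)"
  define f' g' where "f' = f(p := u)" and "g' = g(p := v)"
  have "\<forall>i<Suc p. f' i \<in> S \<and> g' i \<in> S \<and> E (f' i) (g' i)"
    using edges assms(2-4) by (auto simp: f'_def g'_def less_Suc_eq)
  moreover have "\<forall>i<Suc p. \<forall>j<Suc p. i \<noteq> j \<longrightarrow> \<not> linked E (f' i) (g' i) (f' j) (g' j)"
    using edges unlinked by (auto simp: f'_def g'_def less_Suc_eq linked_def far_from_def commute)
  ultimately show False using assms(1) unfolding matching_free_def by blast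
qed

lemma matching_free_2_linked:
  assumes "matching_free E S 2" "{a, b, c, d} \<subseteq> S" "E a b" "E c d"
  shows "linked E a b c d"
proof (rule ccontr)
  assume unlinked: "\<not> ?thesis"
  have "matching_free E {w \<in> S. far_from E a b w} 1"
    using matching_free_far[of S 1 a b] assms by (simp add: numeral_2_eq_2)
  moreover have "c \<in> {w \<in> S. far_from E a b w}" "d \<in> {w \<in> S. far_from E a b w}"
    using assms(2) unlinked by (auto simp: far_from_def linked_def)
  ultimately show False
    using matching_free_far[of "{w \<in> S. far_from E a b w}" 0 c d] assms(4) not_matching_free_0
    by auto
qed

lemma matching_free_3_linked:
  assumes "matching_free E S 3" "{a, b, c, d, e, f} \<subseteq> S" "E a b" "E c d" "E e f"
  shows "linked E a b c d \<or> linked E a b e f \<or> linked E c d e f"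
proof -
  have "matching_free E {w \<in> S. far_from E a b w} 2"
    using matching_free_far[of S 2 a b] assms by (simp add: numeral_3_eq_3 numeral_2_eq_2)
  from matching_free_2_linked[OF this, of c d e f] show ?thesis
    using assms by (auto simp: far_from_def linked_def)
qed

end

section \<open>Graphs without an induced path on four vertices\<close>

definition maximal_stable :: "('a \<Rightarrow> 'a \<Rightarrow> bool) \<Rightarrow> 'a set \<Rightarrow> 'a set \<Rightarrow> bool" where
  "maximal_stable E S I \<longleftrightarrow> I \<subseteq> S \<and> stable_set E I \<and> (\<forall>x\<in>S - I. \<exists>s\<in>I. E x s)"

context adjacency
begin

lemma ex_maximal_stable:
  assumes "finite S"
  shows "\<exists>I. maximal_stable E S I"
proof -
  let ?C = "{I. I \<subseteq> S \<and> stable_set E I}"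
  have "{} \<in> ?C" by (simp add: stable_set_def)
  then have "?C \<noteq> {}" by blast
  moreover have "finite ?C" using assms by simp
  ultimately have "\<exists>I\<in>?C. \<forall>J\<in>?C. I \<subseteq> J \<longrightarrow> I = J" by (intro finite_has_maximal)
  then obtain I where I: "I \<in> ?C" and maximal: "\<forall>J\<in>?C. I \<subseteq> J \<longrightarrow> I = J" ..
  have "\<exists>s\<in>I. E x s" if x: "x \<in> S - I" for x
  proof (rule ccontr)
    assume "\<not> ?thesis"
    then have "insert x I \<in> ?C" using I x irrefl sym unfolding stable_set_def by blast
    then show False using maximal x by blast
  qed
  then show ?thesis using I unfolding maximal_stable_def by blast
qed

lemma maximal_stable_meets_maximal_clique:
  assumes "finite S" "path4_free E S" "maximal_stable E S I"
    and K: "K \<subseteq> S" "K \<noteq> {}" "pairwise E K" and Kmax: "\<And>x. x \<in> S \<Longrightarrow> \<exists>k\<in>K. \<not> E x k"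
  shows "K \<inter> I \<noteq> {}"
proof
  assume disj: "K \<inter> I = {}"
  have I: "I \<subseteq> S" "stable_set E I" and dominating: "\<And>x. x \<in> S - I \<Longrightarrow> \<exists>s\<in>I. E x s"
    using assms(3) by (auto simp: maximal_stable_def)
  have fin: "finite I" "finite K" using assms(1) I(1) K(1) finite_subset by auto
  have "I \<noteq> {}" using K(1,2) disj dominating by blast
  define N where "N s = {k \<in> K. E s k}" for s
  obtain s where s: "s \<in> I" "\<And>t. t \<in> I \<Longrightarrow> card (N t) \<le> card (N s)"
    using obtains_MAX[OF fin(1) \<open>I \<noteq> {}\<close>, of "\<lambda>s. card (N s)"] fin(1)
    by (metis Max_ge finite_imageI imageI)
  obtain k where k: "k \<in> K" "\<not> E s k" using Kmax[of s] s(1) I(1) by blast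
  obtain t where t: "t \<in> I" "E k t" using dominating[of k] k(1) K(1) disj by blast
  have "\<not> N s \<subseteq> N t"
  proof
    assume "N s \<subseteq> N t"
    then have "N s \<subset> N t" using k t sym unfolding N_def by blast
    then have "card (N s) < card (N t)" using fin(2) by (intro psubset_card_mono) (simp add: N_def)
    then show False using s(2)[OF t(1)] by simp
  qed
  then obtain l where l: "l \<in> K" "E s l" "\<not> E t l" unfolding N_def by blast
  have "E l k" using K(3) k l unfolding pairwise_def by metis
  moreover have "\<not> E s t" using I(2) s(1) t(1) by (simp add: stable_set_def)
  ultimately show False
    using assms(2) l k t s(1) K(1) I(1) sym unfolding path4_free_def by blast
qed

lemma cliques_le_diff_maximal_stable:
  assumes "finite S" "path4_free E S" "maximal_stable E S I" "cliques_le E S (Suc m)"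
  shows "cliques_le E (S - I) m"
  unfolding cliques_le_def
proof (intro allI impI, rule ccontr)
  fix K assume K: "K \<subseteq> S - I" "pairwise E K" "\<not> card K \<le> m"
  have "\<exists>k\<in>K. \<not> E x k" if "x \<in> S" for x
    using card_extendable_clique_less[OF assms(1,4) _ K(2) that] K(1,3) by auto
  moreover have "K \<noteq> {}" using K(3) by auto
  ultimately have "K \<inter> I \<noteq> {}"
    using maximal_stable_meets_maximal_clique[OF assms(1-3)] K(1,2) by blast
  then show False using K(1) by blast
qed

lemma path4_free_colourable:
  assumes "finite S" "path4_free E S" "cliques_le E S m"
  shows "colourable E S m"
  using assms
proof (induction m arbitrary: S)
  case 0
  have "S = {}"
    using card_extendable_clique_less[OF 0(1,3), of "{}"] by auto
  then show ?case by (simp add: colourable_def)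
next
  case (Suc m)
  obtain I where I: "maximal_stable E S I"
    using ex_maximal_stable Suc.prems(1) by blast
  have "path4_free E (S - I)" using Suc.prems(2) by (auto simp: path4_free_def)
  then have "colourable E (S - I) m"
    using Suc cliques_le_diff_maximal_stable[OF Suc.prems(1,2) I] by blast
  then have "colourable E ((S - I) \<union> I) (m + 1)"
    using I by (intro colourable_union colourable_stable_set) (simp_all add: maximal_stable_def)
  then show ?case by (rule colourable_subset[THEN colourable_mono]) auto
qed

lemma colourable_if_cliques_le_1:
  assumes "finite S" "cliques_le E S m" "m \<le> 1"
  shows "colourable E S m"
proof (rule path4_free_colourable[OF assms(1) _ assms(2)])
  have "stable_set E S"
    using assms(2,3) by (rule stable_set_if_cliques_le_1[OF cliques_le_mono])
  then show "path4_free E S" by (auto simp: path4_free_def stable_set_def)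
qed

lemma neighbours_colourable:
  assumes "finite S" "gem_free E S" "cliques_le E S m" "u \<in> S"
  shows "colourable E {w \<in> S. E u w} (m - 1)"
proof (rule path4_free_colourable)
  show "finite {w \<in> S. E u w}" using assms(1) by simp
  show "path4_free E {w \<in> S. E u w}" using assms(2,4) by (simp add: gem_free_def)
  show "cliques_le E {w \<in> S. E u w} (m - 1)"
    unfolding cliques_le_def
  proof (intro allI impI)
    fix K assume K: "K \<subseteq> {w \<in> S. E u w}" "pairwise E K"
    have "card K < m"
      by (rule card_extendable_clique_less[OF assms(1,3) _ K(2) assms(4)]) (use K(1) in auto)
    then show "card K \<le> m - 1" by simp
  qed
qed

lemma colourable_if_far_colourable:
  assumes "finite S" "gem_free E S" "cliques_le E S m" "m \<ge> 2"
    and far: "\<And>u v. u \<in> S \<Longrightarrow> v \<in> S \<Longrightarrow> E u v \<Longrightarrow> colourable E {w \<in> S. far_from E u v w} k"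
  shows "colourable E S (k + 2 * (m - 1))"
proof (cases "stable_set E S")
  case True
  then show ?thesis using assms(4) by (intro colourable_mono[OF colourable_stable_set]) auto
next
  case False
  then obtain u v where uv: "u \<in> S" "v \<in> S" "E u v" unfolding stable_set_def by blast
  have "colourable E ({w \<in> S. far_from E u v w} \<union> {w \<in> S. E u w} \<union> {w \<in> S. E v w})
      (k + (m - 1) + (m - 1))"
    by (intro colourable_union neighbours_colourable assms far uv)
  then show ?thesis by (rule colourable_subset[THEN colourable_mono]) (auto simp: far_from_def)
qed

end

section \<open>Graphs without $2K_2$ and gem\<close>

lemma ex_representatives_inj_on_pairs:
  assumes "card K = 3"
  shows "\<exists>g. (\<forall>A. A \<noteq> {} \<longrightarrow> g A \<in> A) \<and> inj_on g {A. A \<subseteq> K \<and> card A = 2}"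
proof -
  obtain a b c where K: "K = {a, b, c}" and ne: "a \<noteq> b" "b \<noteq> c" "a \<noteq> c"
    using assms unfolding card_3_iff by blast
  define g where "g A = (if A = {a, b} then a else if A = {b, c} then b
    else if A = {a, c} then c else (SOME x. x \<in> A))" for A
  have "{A. A \<subseteq> K \<and> card A = 2} \<subseteq> {{a, b}, {b, c}, {a, c}}"
    by (auto simp: K card_2_iff)
  moreover have "inj_on g {{a, b}, {b, c}, {a, c}}"
    using ne by (auto simp: g_def inj_on_def doubleton_eq_iff)
  ultimately have "inj_on g {A. A \<subseteq> K \<and> card A = 2}" by (rule inj_on_subset[rotated])
  moreover have "g A \<in> A" if "A \<noteq> {}" for A using that some_in_eq[of A] by (auto simp: g_def)
  ultimately show ?thesis by (intro exI[of _ g]) simp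
qed

locale two_K2_gem_free = adjacency +
  fixes S K :: "'a set"
  assumes finite: "finite S" and gem_free: "gem_free E S" and two_K2_free: "matching_free E S 2"
    and K_sub: "K \<subseteq> S" and K_clique: "pairwise E K"
    and K_max: "cliques_le E S (card K)" and K_card: "card K \<ge> 3"
begin

definition nonneighbours :: "'a \<Rightarrow> 'a set" where
  "nonneighbours x = {k \<in> K. \<not> E x k}"

definition clash :: "'a \<Rightarrow> 'a \<Rightarrow> 'a \<Rightarrow> bool" where
  "clash x y b \<longleftrightarrow> x \<in> S \<and> y \<in> S \<and> E x y \<and> nonneighbours x \<inter> nonneighbours y = {b}"

lemma finite_K: "finite K"
  using finite K_sub finite_subset by blast

lemma nonneighbours_subset: "nonneighbours x \<subseteq> K"
  by (auto simp: nonneighbours_def)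

lemma no_gem:
  "\<lbrakk>{e, a, b, c, d} \<subseteq> S; E e a; E e b; E e c; E e d; E a b; E b c; E c d\<rbrakk> \<Longrightarrow> E a c \<or> E a d \<or> E b d"
  using gem_free unfolding gem_free_def path4_free_def by blast

lemma K_adjacent: "a \<in> K \<Longrightarrow> b \<in> K \<Longrightarrow> a \<noteq> b \<Longrightarrow> E a b"
  using K_clique by (auto simp: pairwise_def)

lemma nonneighbours_nonempty: "x \<in> S \<Longrightarrow> nonneighbours x \<noteq> {}"
  using card_extendable_clique_less[OF finite K_max K_sub K_clique]
  unfolding nonneighbours_def by blast

lemma clash_sym: "clash x y b \<Longrightarrow> clash y x b"
  using sym by (simp add: clash_def Int_commute)

lemma clash_if_common_nonneighbour:
  assumes "x \<in> S" "y \<in> S" "E x y" "b \<in> nonneighbours x" "b \<in> nonneighbours y"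
  shows "clash x y b"
proof -
  have b: "b \<in> K" "\<not> E x b" "\<not> E y b" using assms(4,5) by (simp_all add: nonneighbours_def)
  have "c = b" if "c \<in> K" "\<not> E x c" "\<not> E y c" for c
  proof (rule ccontr)
    assume "c \<noteq> b"
    then have "E c b" using that(1) b(1) by (intro K_adjacent)
    then have "linked E x y c b"
      using that(1) b(1) assms(1-3) K_sub by (intro matching_free_2_linked[OF two_K2_free]) auto
    then show False using that(2,3) b(2,3) by (simp add: linked_def)
  qed
  then have "nonneighbours x \<inter> nonneighbours y = {b}"
    using assms(4,5) by (auto simp: nonneighbours_def)
  then show ?thesis using assms(1-3) by (simp add: clash_def)
qed

lemma clash_adjacent_iff:
  assumes "clash x y b" "k \<in> nonneighbours x"
  shows "E y k \<longleftrightarrow> k \<noteq> b"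
proof -
  have "k \<in> nonneighbours y \<longleftrightarrow> k = b" using assms by (auto simp: clash_def)
  then show ?thesis using assms(2) by (auto simp: nonneighbours_def)
qed

lemma clash_no_common_neighbour:
  assumes "clash x y b" "a \<in> nonneighbours x" "a \<noteq> b" "k \<in> K"
  shows "\<not> (E x k \<and> E y k)"
proof
  assume k: "E x k \<and> E y k"
  have xy: "x \<in> S" "y \<in> S" "E x y" and b: "b \<in> nonneighbours x"
    using assms(1) by (auto simp: clash_def)
  have ab: "a \<in> K" "b \<in> K" "\<not> E x a" "\<not> E x b" "\<not> E y b" "E y a"
    using clash_adjacent_iff[OF assms(1)] assms(2,3) b by (simp_all add: nonneighbours_def)
  then have "E a b" "E k a" "E k b" using k assms(3,4) by (auto intro: K_adjacent)
  then show False
    using no_gem[of k x y a b] ab k xy assms(4) K_sub sym by blast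
qed

lemma clash_not_both_single:
  assumes "clash x y b" "nonneighbours x = {b}"
  shows "nonneighbours y \<noteq> {b}"
proof
  assume y: "nonneighbours y = {b}"
  have xy: "x \<in> S" "y \<in> S" "E x y" using assms(1) by (simp_all add: clash_def)
  have b: "b \<in> K" using y by (auto simp: nonneighbours_def)
  have adj: "E x k" "E y k" if "k \<in> K - {b}" for k
    using assms(2) y that by (auto simp: nonneighbours_def)
  then have "x \<notin> K - {b}" using irrefl by blast
  then have "card (insert x (K - {b})) = card K"
    using finite_K card_Suc_Diff1[OF finite_K b] by simp
  moreover have "pairwise E (insert x (K - {b}))"
    using K_clique adj(1) sym by (auto simp: pairwise_def)
  moreover have "E y k" if "k \<in> insert x (K - {b})" for k using that adj(2) xy(3) sym by blast
  ultimately show False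
    using card_extendable_clique_less[OF finite K_max, of "insert x (K - {b})" y] xy(1,2) K_sub
    by auto
qed

lemma clash_card_nonneighbours:
  assumes "clash x y b"
  shows "card (nonneighbours x) + card (nonneighbours y) = card K + 1"
proof -
  have common: "nonneighbours x \<inter> nonneighbours y = {b}" using assms by (simp add: clash_def)
  then obtain a where "a \<noteq> b" "a \<in> nonneighbours x \<or> a \<in> nonneighbours y"
    using clash_not_both_single[OF assms] by blast
  then have "\<not> (E x k \<and> E y k)" if "k \<in> K" for k
    using clash_no_common_neighbour[OF assms _ _ that]
      clash_no_common_neighbour[OF clash_sym[OF assms] _ _ that] by blast
  then have "nonneighbours x \<union> nonneighbours y = K" by (auto simp: nonneighbours_def)
  then show ?thesis
    using card_Un_Int[of "nonneighbours x" "nonneighbours y"] common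
      finite_subset[OF nonneighbours_subset finite_K] by simp
qed

text \<open>
  Every vertex \<open>x\<close> is given one of its non-neighbours in \<open>K\<close> as colour. Since adjacent vertices have
  at most one common non-neighbour, it suffices that in each clashing edge one end has a safe
  colour.
\<close>

definition safe :: "'a \<Rightarrow> 'a \<Rightarrow> bool" where
  "safe x b \<longleftrightarrow> (\<forall>y. \<not> clash x y b)"

lemma clashing_vertices_adjacent:
  assumes "card (nonneighbours x) \<ge> 3" and y: "clash x y b" and z: "clash x z c" and "b \<noteq> c"
  shows "E y z"
proof (rule ccontr)
  assume "\<not> E y z"
  have "\<not> nonneighbours x \<subseteq> {b, c}"
    using assms(1) \<open>b \<noteq> c\<close> card_mono[of "{b, c}" "nonneighbours x"] by auto
  then obtain d where d: "d \<in> nonneighbours x" "d \<noteq> b" "d \<noteq> c" by blast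
  have bc: "b \<in> nonneighbours x" "c \<in> nonneighbours x" and yz: "y \<in> S" "z \<in> S"
    using y z by (auto simp: clash_def)
  then have bcd: "b \<in> K" "c \<in> K" "d \<in> K" using d(1) by (simp_all add: nonneighbours_def)
  have "E y c" "E y d" "E z b" "E z d" "\<not> E y b" "\<not> E z c"
    using clash_adjacent_iff[OF y] clash_adjacent_iff[OF z] bc d \<open>b \<noteq> c\<close> by simp_all
  moreover have "E c b" "E d b" "E d c" using bcd d \<open>b \<noteq> c\<close> by (simp_all add: K_adjacent)
  moreover have "{d, y, c, b, z} \<subseteq> S" using bcd K_sub yz by blast
  ultimately show False
    using no_gem[of d y c b z] \<open>\<not> E y z\<close> sym by blast
qed

lemma ex_safe_colour_if_no_neighbour_in_K:
  assumes "x \<in> S" "nonneighbours x = K"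
  shows "\<exists>b\<in>K. safe x b"
proof (rule ccontr)
  assume "\<not> ?thesis"
  then obtain f where f: "\<And>b. b \<in> K \<Longrightarrow> clash x (f b) b"
    unfolding safe_def by metis
  have f_adj: "E (f b) (f c)" if "b \<in> K" "c \<in> K" "b \<noteq> c" for b c
    using clashing_vertices_adjacent[OF _ f[OF that(1)] f[OF that(2)] that(3)] assms(2) K_card
    by simp
  then have "inj_on f K" using irrefl by (metis inj_onI)
  then have "card (f ` K) = card K" by (rule card_image)
  moreover have "pairwise E (f ` K)" using f_adj by (auto simp: pairwise_def)
  ultimately show False
    using card_extendable_clique_less[OF finite K_max, of "f ` K" x] f assms(1)
    by (auto simp: clash_def)
qed

lemma ex_safe_colour:
  assumes "x \<in> S" "card (nonneighbours x) \<ge> 3"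
  shows "\<exists>b\<in>nonneighbours x. safe x b"
proof (cases "nonneighbours x = K")
  case True
  then show ?thesis using ex_safe_colour_if_no_neighbour_in_K assms(1) by simp
next
  case False
  then obtain k where k: "k \<in> K" "E x k" by (auto simp: nonneighbours_def)
  obtain T where "T \<subseteq> nonneighbours x" "card T = 3"
    using obtain_subset_with_card_n[OF assms(2)] by blast
  then obtain b c d where bc: "b \<in> nonneighbours x" "c \<in> nonneighbours x" "b \<noteq> c"
    and d: "d \<in> nonneighbours x" "d \<noteq> b" "d \<noteq> c"
    unfolding card_3_iff by blast
  show ?thesis
  proof (rule ccontr)
    assume "\<not> ?thesis"
    then obtain y z where y: "clash x y b" and z: "clash x z c"
      using bc unfolding safe_def by meson
    have "\<not> E y k" "\<not> E z k"
      using clash_no_common_neighbour[OF y d(1,2) k(1)]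
        clash_no_common_neighbour[OF z d(1,3) k(1)] k(2) by blast+
    moreover have "E y z" by (rule clashing_vertices_adjacent[OF assms(2) y z bc(3)])
    moreover have "E d y" "E d z" "E z b" "\<not> E y b"
      using clash_adjacent_iff[OF y] clash_adjacent_iff[OF z] d bc by (simp_all add: commute[of d])
    moreover have K: "b \<in> K" "d \<in> K" "b \<noteq> k" "d \<noteq> k"
      using bc d k by (auto simp: nonneighbours_def)
    then have "E d b" "E d k" "E b k" using d(2) k(1) by (simp_all add: K_adjacent)
    moreover have "{d, y, z, b, k} \<subseteq> S" using y z K k(1) K_sub by (auto simp: clash_def)
    ultimately show False using no_gem[of d y z b k] by blast
  qed
qed

lemma ex_representatives:
  obtains g where "\<And>A. A \<noteq> {} \<Longrightarrow> g A \<in> A"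
    and "card K = 3 \<Longrightarrow> inj_on g {A. A \<subseteq> K \<and> card A = 2}"
proof (cases "card K = 3")
  case True
  then show ?thesis using ex_representatives_inj_on_pairs that by blast
next
  case False
  then show ?thesis using that[of "\<lambda>A. SOME x. x \<in> A"] by (simp add: some_in_eq)
qed

lemma colourable_by_maximum_clique: "colourable E S (card K)"
proof -
  obtain g where g: "\<And>A. A \<noteq> {} \<Longrightarrow> g A \<in> A"
    and g_inj: "card K = 3 \<Longrightarrow> inj_on g {A. A \<subseteq> K \<and> card A = 2}"
    using ex_representatives by blast
  have "\<exists>b\<in>nonneighbours x.
      if card (nonneighbours x) \<ge> 3 then safe x b else b = g (nonneighbours x)"
    if "x \<in> S" for x
    using ex_safe_colour[OF that] g[OF nonneighbours_nonempty[OF that]] by auto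
  then obtain c where c: "\<And>x. x \<in> S \<Longrightarrow> c x \<in> nonneighbours x"
    and large: "\<And>x. x \<in> S \<Longrightarrow> card (nonneighbours x) \<ge> 3 \<Longrightarrow> safe x (c x)"
    and small: "\<And>x. x \<in> S \<Longrightarrow> \<not> card (nonneighbours x) \<ge> 3 \<Longrightarrow> c x = g (nonneighbours x)"
    by metis
  show ?thesis
  proof (rule colourableI[OF finite_K])
    show "c x \<in> K" if "x \<in> S" for x using c[OF that] nonneighbours_subset by blast
    fix x y assume xy: "x \<in> S" "y \<in> S" "E x y"
    show "c x \<noteq> c y"
    proof
      assume eq: "c x = c y"
      then have clash: "clash x y (c x)"
        using clash_if_common_nonneighbour[OF xy] c xy(1,2) by metis
      then have le_2: "\<not> card (nonneighbours x) \<ge> 3" "\<not> card (nonneighbours y) \<ge> 3"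
        using large[OF xy(1)] large[OF xy(2)] clash_sym eq unfolding safe_def by metis+
      then have card_2: "card (nonneighbours x) = 2" "card (nonneighbours y) = 2" "card K = 3"
        using clash_card_nonneighbours[OF clash] K_card by linarith+
      have "g (nonneighbours x) = g (nonneighbours y)"
        using small[OF xy(1) le_2(1)] small[OF xy(2) le_2(2)] eq by simp
      then have "nonneighbours x = nonneighbours y"
        using inj_onD[OF g_inj[OF card_2(3)]] card_2(1,2) nonneighbours_subset by blast
      then show False using clash card_2(1) by (simp add: clash_def)
    qed
  qed
qed

end

lemma (in adjacency) two_K2_gem_free_colourable:
  assumes "finite S" "gem_free E S" "cliques_le E S m" "matching_free E S 2"
  shows "colourable E S (max 3 m)"
proof -
  obtain K where K: "K \<subseteq> S" "pairwise E K" and K_max: "cliques_le E S (card K)"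
    using ex_maximum_clique[OF assms(1)] by blast
  show ?thesis
  proof (cases "card K \<ge> 3")
    case True
    interpret two_K2_gem_free E S K
      by unfold_locales (use assms K K_max True in auto)
    have "card K \<le> m" using cliques_leD assms(3) K by blast
    then show ?thesis by (intro colourable_mono[OF colourable_by_maximum_clique]) simp
  next
    case False
    then have cliques: "cliques_le E S 2" using cliques_le_mono[OF K_max] by simp
    have "colourable E {w \<in> S. far_from E u v w} 1" if "u \<in> S" "v \<in> S" "E u v" for u v
    proof (intro colourable_stable_set stable_setI notI)
      fix x y assume "x \<in> {w \<in> S. far_from E u v w}" "y \<in> {w \<in> S. far_from E u v w}" "E x y"
      then show False
        using matching_free_2_linked[OF assms(4), of u v x y] that
        by (simp add: far_from_def linked_def)
    qed
    then have "colourable E S (1 + 2 * (2 - 1))"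
      by (intro colourable_if_far_colourable[OF assms(1,2) cliques]) auto
    then show ?thesis by (rule colourable_mono) simp
  qed
qed

section \<open>Triangle-free graphs without $3K_2$\<close>

text \<open>Cyclic sequences of length five are indexed by the type \<open>5\<close> of residues modulo 5.\<close>

lemma residue_5_cases:
  obtains "j = (i::5)" | "j = i + 1" | "j = i + 2" | "j = i - 2" | "j = i - 1"
proof -
  have "j - i = 0 \<or> j - i = 1 \<or> j - i = 2 \<or> j - i = -2 \<or> j - i = -1"
  proof (cases "j - i")
    case (of_int z)
    then have "z \<in> {0, 1, 2, 3, 4}" by auto
    then show ?thesis using of_int(1) by auto
  qed
  then show thesis using that by (auto simp: diff_eq_eq add.commute[of _ i])
qed

lemma residue_5_shifts:
  "(i::5) + 1 + 1 = i + 2" "i + 1 + 2 = i - 2" "i + 2 + 1 = i - 2" "i + 2 + 2 = i - 1"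
  "i - 1 - 1 = i - 2" "i - 1 - 2 = i + 2" "i - 2 - 1 = i + 2" "i - 2 - 2 = i + 1"
  "i + 1 - 1 = i" "i + 1 - 2 = i - 1" "i + 2 - 1 = i + 1" "i + 2 - 2 = i"
  "i - 1 + 1 = i" "i - 1 + 2 = i + 1" "i - 2 + 1 = i - 1" "i - 2 + 2 = i"
  by (simp_all add: algebra_simps)

lemma residue_5_distinct:
  "(i::5) \<noteq> i + 1" "i \<noteq> i + 2" "i \<noteq> i - 2" "i \<noteq> i - 1" "i + 1 \<noteq> i + 2"
  "i + 1 \<noteq> i - 2" "i + 1 \<noteq> i - 1" "i + 2 \<noteq> i - 2" "i + 2 \<noteq> i - 1" "i - 2 \<noteq> i - 1"
  by (simp_all add: algebra_simps)

lemmas residue_5 = residue_5_shifts residue_5_distinct residue_5_distinct[symmetric]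

lemma independent_residues_5:
  assumes "\<And>i::5. \<not> (P i \<and> P (i + 1))"
  shows "\<exists>m. \<forall>j. P j \<longrightarrow> j = m - 1 \<or> j = m + 1"
proof (cases "\<exists>i. P i")
  case True
  then obtain i where "P i" ..
  then have i: "\<not> P (i + 1)" "\<not> P (i - 1)" "\<not> (P (i + 2) \<and> P (i - 2))"
    using assms[of i] assms[of "i - 1"] assms[of "i + 2"] by (auto simp: residue_5)
  define m where "m = (if P (i + 2) then i + 1 else i - 1)"
  have "j = m - 1 \<or> j = m + 1" if "P j" for j
    by (cases j i rule: residue_5_cases) (use that i in \<open>auto simp: m_def residue_5\<close>)
  then show ?thesis by blast
qed blast

lemma ex_five_cycle_enumeration:
  assumes "E a b" "E b c" "E c d" "E d e" "E e a" "{a, b, c, d, e} \<subseteq> A"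
  shows "\<exists>f :: 5 \<Rightarrow> 'a. \<forall>i. f i \<in> A \<and> E (f i) (f (i + 1))"
proof -
  define f :: "5 \<Rightarrow> 'a" where "f = (\<lambda>_. a)(1 := b, 2 := c, -2 := d, -1 := e)"
  have "f i \<in> A \<and> E (f i) (f (i + 1))" for i
    by (cases i "0::5" rule: residue_5_cases) (use assms in \<open>simp_all add: f_def\<close>)
  then show ?thesis by blast
qed

locale triangle_free_graph =
  fixes E :: "'a \<Rightarrow> 'a \<Rightarrow> bool"
  assumes sym: "E x y \<Longrightarrow> E y x" and triangle_free: "E x y \<Longrightarrow> E y z \<Longrightarrow> \<not> E x z"
begin

sublocale adjacency E
  by unfold_locales (use sym triangle_free in blast)+

lemma stable_set_neighbours: "stable_set E {y \<in> A. E x y}"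
  using triangle_free sym unfolding stable_set_def by blast

lemma two_colourable_if_no_five_cycle:
  assumes two_K2_free: "matching_free E A 2"
    and no_cycle: "\<not> (\<exists>f :: 5 \<Rightarrow> 'a. \<forall>i. f i \<in> A \<and> E (f i) (f (i + 1)))"
  shows "colourable E A 2"
proof (cases "stable_set E A")
  case True
  then show ?thesis by (rule colourable_mono[OF colourable_stable_set]) simp
next
  case False
  then obtain a b where ab: "a \<in> A" "b \<in> A" "E a b" unfolding stable_set_def by blast
  define R where "R = {r \<in> A. far_from E a b r}"
  define Q where "Q = {r \<in> R. \<exists>s\<in>A. E a s \<and> E r s}"
  have "\<not> E r s" if "r \<in> R" "s \<in> R" for r s
    using matching_free_2_linked[OF two_K2_free, of a b r s] ab that
    by (auto simp: R_def far_from_def linked_def)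
  then have R: "stable_set E Q" "stable_set E (R - Q)" by (auto simp: Q_def stable_set_def)
  have Q: "\<not> E y r" if y: "y \<in> A" "E b y" and r: "r \<in> Q" for y r
  proof
    assume "E y r"
    obtain s where s: "s \<in> A" "E a s" "E r s" and "r \<in> A" using r by (auto simp: Q_def R_def)
    then show False
      using ex_five_cycle_enumeration[of E y r s a b A] no_cycle ab y \<open>E y r\<close> sym by auto
  qed
  have "stable_set E ({y \<in> A. E b y} \<union> Q)"
    by (rule stable_set_union[OF stable_set_neighbours R(1)]) (use Q sym in blast)
  moreover have "stable_set E ({y \<in> A. E a y} \<union> (R - Q))"
    by (rule stable_set_union[OF stable_set_neighbours R(2)]) (use sym in \<open>unfold Q_def, blast\<close>)
  ultimately have "colourable E (({y \<in> A. E b y} \<union> Q) \<union> ({y \<in> A. E a y} \<union> (R - Q))) (1 + 1)"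
    by (intro colourable_union colourable_stable_set)
  then show ?thesis
    by (rule colourable_subset[THEN colourable_mono]) (auto simp: R_def far_from_def)
qed

end

locale far_five_cycle = triangle_free_graph +
  fixes u v :: 'a and a :: "5 \<Rightarrow> 'a"
  assumes three_K2_free: "matching_free E UNIV 3" and uv: "E u v"
    and cycle: "E (a i) (a (i + 1))" and cycle_far: "far_from E u v (a i)"
begin

abbreviation far :: "'a \<Rightarrow> bool" where
  "far \<equiv> far_from E u v"

definition bag :: "5 \<Rightarrow> 'a set" where
  "bag i = {w. far w \<and> E w (a (i - 1)) \<and> E w (a (i + 1))}"

definition touches :: "'a \<Rightarrow> 5 \<Rightarrow> bool" where
  "touches x i \<longleftrightarrow> (\<exists>w\<in>bag i. E x w)"

definition isolated :: "'a \<Rightarrow> bool" where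
  "isolated z \<longleftrightarrow> far z \<and> (\<forall>i. z \<notin> bag i)"

lemma three_edges_linked:
  "E b c \<Longrightarrow> E d e \<Longrightarrow> E f g \<Longrightarrow> linked E b c d e \<or> linked E b c f g \<or> linked E d e f g"
  using matching_free_3_linked[OF three_K2_free] by simp

lemma far_edges_linked: "\<lbrakk>far b; far c; far d; far e; E b c; E d e\<rbrakk> \<Longrightarrow> linked E b c d e"
  using three_edges_linked[OF uv, of b c d e] by (auto simp: linked_def far_from_def)

lemma cycle_back: "E (a i) (a (i - 1))"
  using cycle[of "i - 1"] sym by (simp add: residue_5)

lemma cycle_no_chord: "\<not> E (a i) (a (i + 2))" "\<not> E (a i) (a (i - 2))"
  using triangle_free[OF cycle[of i] cycle[of "i + 1"]]
    triangle_free[OF cycle_back[of i] cycle_back[of "i - 1"]] by (simp_all add: residue_5)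

lemma far_neighbour_in_bag:
  assumes "far w" "E w (a i)"
  shows "w \<in> bag (i + 1) \<union> bag (i - 1)"
proof -
  have "linked E w (a i) (a (i + 2)) (a (i - 2))"
    using cycle[of "i + 2"] assms cycle_far by (intro far_edges_linked) (simp_all add: residue_5)
  then have "E w (a (i + 2)) \<or> E w (a (i - 2))"
    using cycle_no_chord by (auto simp: linked_def)
  then show ?thesis using assms by (auto simp: bag_def residue_5)
qed

lemma bag_complete_to_next:
  assumes "w \<in> bag i" "w' \<in> bag (i + 1)"
  shows "E w w'"
proof -
  have w: "far w" "E w (a (i - 1))" "E w (a (i + 1))"
    and w': "far w'" "E w' (a i)" "E w' (a (i + 2))"
    using assms by (simp_all add: bag_def residue_5)
  have "linked E w (a (i - 1)) w' (a (i + 2))"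
    using w w' cycle_far by (intro far_edges_linked)
  moreover have "\<not> E w (a (i + 2))"
    using triangle_free[OF w(3) cycle[of "i + 1"]] by (simp add: residue_5)
  moreover have "\<not> E (a (i - 1)) w'" using triangle_free[OF w'(2) cycle_back] sym by blast
  moreover have "\<not> E (a (i - 1)) (a (i + 2))"
    using cycle_no_chord(2)[of "i - 1"] by (simp add: residue_5)
  ultimately show ?thesis by (simp add: linked_def)
qed

lemma adjacent_bags_iff:
  assumes "w \<in> bag i" "w' \<in> bag j"
  shows "E w w' \<longleftrightarrow> j = i + 1 \<or> j = i - 1"
proof (cases j i rule: residue_5_cases)
  case 1
  then have "\<not> E w w'"
    using assms triangle_free[of w w' "a (i + 1)"] by (auto simp: bag_def)
  then show ?thesis using 1 by (simp add: residue_5)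
next
  case 2
  then show ?thesis using bag_complete_to_next assms by simp
next
  case 3
  then have "\<not> E w w'"
    using assms triangle_free[of w w' "a (i + 1)"] by (auto simp: bag_def residue_5)
  then show ?thesis using 3 by (simp add: residue_5)
next
  case 4
  then have "\<not> E w w'"
    using assms triangle_free[of w w' "a (i - 1)"] by (auto simp: bag_def residue_5)
  then show ?thesis using 4 by (simp add: residue_5)
next
  case 5
  then show ?thesis using bag_complete_to_next[of w' j w] assms sym by (auto simp: residue_5)
qed

lemma not_touches_consecutive: "\<not> (touches x i \<and> touches x (i + 1))"
  using bag_complete_to_next triangle_free unfolding touches_def by blast

lemma isolated_no_far_neighbour:
  assumes "isolated z" "far w"
  shows "\<not> E z w"
proof
  assume zw: "E z w"
  have z: "far z" "\<not> E z (a i)" for i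
    using assms(1) far_neighbour_in_bag unfolding isolated_def by blast+
  have w: "E w (a i) \<or> E w (a (i + 1))" for i
    using far_edges_linked[OF z(1) assms(2) cycle_far cycle_far zw cycle] z(2)
    by (auto simp: linked_def)
  then obtain i where "w \<in> bag i" using w[of 0] far_neighbour_in_bag assms(2) by blast
  then have "E w (a (i - 1))" "E w (a (i + 1))" by (simp_all add: bag_def)
  then have "\<not> E w (a (i - 2))" "\<not> E w (a (i + 2))"
    using triangle_free[OF _ cycle_back[of "i - 1"], of w]
      triangle_free[OF _ cycle[of "i + 1"], of w]
    by (simp_all add: residue_5)
  then show False using w[of "i + 2"] by (simp add: residue_5)
qed

definition attached :: "'a \<Rightarrow> bool" where
  "attached z \<longleftrightarrow> isolated z \<and> (\<exists>y. E u y \<and> E z y)"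

text \<open>The obstacles to the colouring in which only bag \<open>i\<close> receives the third colour of the cycle.\<close>

definition obstructs :: "'a \<Rightarrow> 5 \<Rightarrow> bool" where
  "obstructs x i \<longleftrightarrow> E v x \<and> touches x (i - 1) \<and> touches x (i + 1) \<and> (\<exists>z. attached z \<and> E z x)"

lemma stable_set_two_bags:
  assumes "k \<noteq> j + 1" "k \<noteq> j - 1"
  shows "stable_set E (bag j \<union> bag k \<union> {x. E v x \<and> \<not> touches x j \<and> \<not> touches x k})"
    (is "stable_set E (_ \<union> ?X)")
proof (intro stable_set_union stable_setI)
  show "\<not> E x y" if "x \<in> bag j" "y \<in> bag j" for x y
    using adjacent_bags_iff[OF that] by (simp add: residue_5)
  show "\<not> E x y" if "x \<in> bag k" "y \<in> bag k" for x y
    using adjacent_bags_iff[OF that] by (simp add: residue_5)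
  show "\<not> E x y \<and> \<not> E y x" if "x \<in> bag j" "y \<in> bag k" for x y
    using adjacent_bags_iff[OF that] assms commute[of y x] by simp
  show "\<not> E x y" if "x \<in> ?X" "y \<in> ?X" for x y
    using that triangle_free sym by blast
  show "\<not> E w x \<and> \<not> E x w" if "w \<in> bag j \<union> bag k" "x \<in> ?X" for w x
    using that sym unfolding touches_def by blast
qed

lemma stable_set_unobstructed_bag:
  assumes "\<And>x. \<not> obstructs x i"
  shows "stable_set E (bag i \<union> {x. E v x \<and> touches x (i - 1) \<and> touches x (i + 1)} \<union> {z. attached z})"
    (is "stable_set E (_ \<union> ?X \<union> ?Z)")
proof (intro stable_set_union stable_setI)
  show "\<not> E x y" if "x \<in> bag i" "y \<in> bag i" for x y
    using adjacent_bags_iff[OF that] by (simp add: residue_5)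
  show "\<not> E x y" if "x \<in> ?X" "y \<in> ?X" for x y
    using that triangle_free sym by blast
  show "\<not> E x y" if "x \<in> ?Z" "y \<in> ?Z" for x y
    using that isolated_no_far_neighbour by (simp add: attached_def isolated_def)
  show "\<not> E w x \<and> \<not> E x w" if "w \<in> bag i" "x \<in> ?X" for w x
    using that not_touches_consecutive[of x i] sym unfolding touches_def by blast
  show "\<not> E x z \<and> \<not> E z x" if "x \<in> bag i \<union> ?X" "z \<in> ?Z" for x z
  proof -
    have "\<not> E z x"
    proof (cases "x \<in> bag i")
      case True
      then show ?thesis using that(2) isolated_no_far_neighbour by (simp add: attached_def bag_def)
    next
      case False
      then show ?thesis using that assms[of x] unfolding obstructs_def by blast
    qed
    then show ?thesis using sym by blast
  qed
qed

lemma stable_set_u_neighbours: "stable_set E ({w. E u w} \<union> {z. isolated z \<and> \<not> attached z})"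
proof (intro stable_set_union stable_setI)
  show "\<not> E x y" if "x \<in> {w. E u w}" "y \<in> {w. E u w}" for x y
    using that triangle_free sym by blast
  show "\<not> E x y" if "x \<in> {z. isolated z \<and> \<not> attached z}"
    "y \<in> {z. isolated z \<and> \<not> attached z}" for x y
    using that isolated_no_far_neighbour by (simp add: isolated_def)
  show "\<not> E w z \<and> \<not> E z w" if "w \<in> {w. E u w}" "z \<in> {z. isolated z \<and> \<not> attached z}" for w z
    using that sym unfolding attached_def by blast
qed

lemma four_colourable_if_unobstructed:
  assumes "\<And>x. \<not> obstructs x i"
  shows "colourable E UNIV 4"
proof -
  let ?W0 = "bag (i + 1) \<union> bag (i - 2) \<union> {x. E v x \<and> \<not> touches x (i + 1) \<and> \<not> touches x (i - 2)}"
  let ?W1 = "bag (i + 2) \<union> bag (i - 1) \<union> {x. E v x \<and> \<not> touches x (i + 2) \<and> \<not> touches x (i - 1)}"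
  let ?W2 = "bag i \<union> {x. E v x \<and> touches x (i - 1) \<and> touches x (i + 1)} \<union> {z. attached z}"
  let ?W3 = "{w. E u w} \<union> {z. isolated z \<and> \<not> attached z}"
  have "stable_set E ?W0" "stable_set E ?W1"
    by (intro stable_set_two_bags; simp add: residue_5)+
  then have col: "colourable E (?W0 \<union> ?W1 \<union> ?W2 \<union> ?W3) (1 + 1 + 1 + 1)"
    using stable_set_unobstructed_bag[OF assms] stable_set_u_neighbours
    by (intro colourable_union colourable_stable_set)
  have "w \<in> ?W0 \<union> ?W1 \<union> ?W2 \<union> ?W3" for w
  proof (cases "E v w")
    case True
    have "\<not> (touches w (i + 1) \<and> touches w (i + 2))" "\<not> (touches w (i + 2) \<and> touches w (i - 2))"
      "\<not> (touches w (i - 2) \<and> touches w (i - 1))"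
      using not_touches_consecutive[of w "i + 1"] not_touches_consecutive[of w "i + 2"]
        not_touches_consecutive[of w "i - 2"] by (simp_all add: residue_5)
    then show ?thesis using True by blast
  next
    case False
    have "w \<in> bag j \<Longrightarrow> ?thesis" for j by (cases j i rule: residue_5_cases) auto
    then show ?thesis using False by (auto simp: isolated_def far_from_def)
  qed
  then have "UNIV \<subseteq> ?W0 \<union> ?W1 \<union> ?W2 \<union> ?W3" by blast
  from colourable_subset[OF col this] show ?thesis by (rule colourable_mono) simp
qed

end

locale five_cycle_with_twins = far_five_cycle +
  fixes x :: "5 \<Rightarrow> 'a"
  assumes v_x: "E v (x i)" and x_touches: "touches (x i) (i - 1)" "touches (x i) (i + 1)"
begin

lemma x_touches_iff: "touches (x i) j \<longleftrightarrow> j = i + 1 \<or> j = i - 1"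
  using x_touches[of i] not_touches_consecutive[of "x i" i]
    not_touches_consecutive[of "x i" "i + 1"] not_touches_consecutive[of "x i" "i - 2"]
  by (cases j i rule: residue_5_cases) (auto simp: residue_5)

lemma x_bag_nonadjacent:
  "w \<in> bag j \<Longrightarrow> j \<notin> {i + 1, i - 1} \<Longrightarrow> \<not> E (x i) w \<and> \<not> E w (x i)"
  using x_touches_iff[of i j] sym unfolding touches_def by blast

lemma x_nonadjacent: "\<not> E (x i) (x j)"
  using v_x triangle_free[of "x i" v "x j"] sym by blast

lemma u_x_nonadjacent: "\<not> E u (x i)"
  using v_x uv triangle_free by blast

lemma isolated_adjacent_next:
  assumes "isolated z" "E z (x i)"
  shows "E z (x (i + 1)) \<or> E z (x (i + 2))"
proof -
  obtain b where b: "b \<in> bag i" "E (x (i + 1)) b"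
    using x_touches(1)[of "i + 1"] by (auto simp: touches_def residue_5)
  obtain c where c: "c \<in> bag (i - 2)" "E (x (i + 2)) c"
    using x_touches(2)[of "i + 2"] by (auto simp: touches_def residue_5)
  have "\<not> E z b" "\<not> E z c" "\<not> E b c"
    using isolated_no_far_neighbour[OF assms(1)] adjacent_bags_iff[OF b(1) c(1)] b(1) c(1)
    by (auto simp: bag_def residue_5)
  moreover have "\<not> E (x i) b" "\<not> E (x i) c" "\<not> E (x (i + 1)) c" "\<not> E b (x (i + 2))"
    using x_bag_nonadjacent[OF b(1)] x_bag_nonadjacent[OF c(1)] by (simp_all add: residue_5)
  ultimately show ?thesis
    using three_edges_linked[OF assms(2) b(2) c(2)] x_nonadjacent by (simp add: linked_def)
qed

lemma u_neighbour_meets: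
  assumes "E u y"
  shows "E y (x i) \<or> E y (x (i + 1)) \<or> touches y (i + 2) \<or> touches y (i - 1)"
proof -
  obtain b where b: "b \<in> bag (i + 2)" "E (x (i + 1)) b"
    using x_touches(2)[of "i + 1"] by (auto simp: touches_def residue_5)
  obtain c where c: "c \<in> bag (i - 1)" "E (x i) c"
    using x_touches(1)[of i] by (auto simp: touches_def)
  have "\<not> E u b" "\<not> E u c" "\<not> E b c"
    using adjacent_bags_iff[OF b(1) c(1)] b(1) c(1) by (auto simp: bag_def far_from_def residue_5)
  moreover have "\<not> E (x (i + 1)) c" "\<not> E b (x i)"
    using x_bag_nonadjacent[OF b(1)] x_bag_nonadjacent[OF c(1)] by (simp_all add: residue_5)
  ultimately have "E y (x (i + 1)) \<or> E y b \<or> E y (x i) \<or> E y c"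
    using three_edges_linked[OF assms b(2) c(2)] x_nonadjacent u_x_nonadjacent
    by (simp add: linked_def)
  then show ?thesis using b(1) c(1) unfolding touches_def by blast
qed

lemma shared_bag_neighbour:
  assumes "isolated z" "E z (x i)" "\<not> E z (x j)" "E u y" "\<not> E z y" "\<not> E y (x i)" "\<not> E y (x j)"
    and "j = i + 1 \<or> j = i - 1"
  shows "\<exists>b\<in>bag i. E (x j) b \<and> E y b"
proof -
  have "touches (x j) i" using assms(8) x_touches_iff by (auto simp: residue_5)
  then obtain b where b: "b \<in> bag i" "E (x j) b" by (auto simp: touches_def)
  have "\<not> E z b" "\<not> E z u" "\<not> E b u"
    using isolated_no_far_neighbour[OF assms(1)] assms(1) b(1)
    by (simp_all add: isolated_def bag_def far_from_def commute[of _ u])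
  moreover have "\<not> E (x i) b" using x_bag_nonadjacent[OF b(1)] by (simp add: residue_5)
  moreover have "\<not> E (x i) u" "\<not> E (x j) u" using u_x_nonadjacent sym by blast+
  ultimately have "E b y"
    using three_edges_linked[OF assms(2) b(2) assms(4)] x_nonadjacent assms(3,5-7)
    by (simp add: linked_def commute[of _ y])
  then show ?thesis using b sym by blast
qed

text \<open>
  The \<open>x i\<close> not seen by an isolated vertex \<open>z\<close>, if not all of them, are pairwise
  non-consecutive, and a neighbour \<open>y\<close> of \<open>u\<close> sees at least two \<open>x i\<close>. If \<open>y\<close> sees \<open>z\<close>,
  this leaves only one arrangement up to rotation.
\<close>

definition arrangement :: "5 \<Rightarrow> 'a \<Rightarrow> 'a \<Rightarrow> bool" where
  "arrangement i z y \<longleftrightarrow> isolated z \<and> E u y \<and>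
     (\<forall>j. E z (x j) \<longleftrightarrow> j \<noteq> i + 1 \<and> j \<noteq> i - 1) \<and> (\<forall>j. E y (x j) \<longleftrightarrow> j = i + 1 \<or> j = i - 1)"

lemma isolated_no_consecutive_nonneighbours:
  assumes "isolated z" "E z (x k)"
  shows "E z (x j) \<or> E z (x (j + 1))"
proof (rule ccontr)
  assume both_missed: "\<not> ?thesis"
  define missed where "missed j \<longleftrightarrow> \<not> E z (x j) \<and> \<not> E z (x (j + 1))" for j
  have step: "missed (j - 1)" if "missed j" for j
    using isolated_adjacent_next[OF assms(1), of "j - 1"] that by (auto simp: missed_def residue_5)
  have "missed j" using both_missed by (simp add: missed_def)
  then have "missed (j - 1)" "missed (j - 2)" "missed (j + 2)" "missed (j + 1)"
    using step[of j] step[of "j - 1"] step[of "j - 2"] step[of "j + 2"] by (simp_all add: residue_5)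
  then show False
    using assms(2) \<open>missed j\<close> by (cases k j rule: residue_5_cases) (simp_all add: missed_def)
qed

lemma ex_arrangement:
  assumes "isolated z" "E u y" "E z y" "E z (x l)"
  shows "\<exists>i. arrangement i z y"
proof -
  have disjoint: "\<not> (E z (x j) \<and> E y (x j))" for j using triangle_free[OF assms(3)] by blast
  obtain m where m: "\<And>j. \<not> E z (x j) \<Longrightarrow> j = m - 1 \<or> j = m + 1"
    using independent_residues_5[of "\<lambda>j. \<not> E z (x j)"]
      isolated_no_consecutive_nonneighbours[OF assms(1,4)] by blast
  obtain k where k: "\<And>j. touches y j \<Longrightarrow> j = k - 1 \<or> j = k + 1"
    using independent_residues_5[of "touches y"] not_touches_consecutive by blast
  have "E y (x (k + 1)) \<or> E y (x (k + 2))"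
    using u_neighbour_meets[OF assms(2), of "k + 1"] k[of k] k[of "k - 2"] by (auto simp: residue_5)
  moreover have "E y (x (k - 2)) \<or> E y (x (k - 1))"
    using u_neighbour_meets[OF assms(2), of "k - 2"] k[of k] k[of "k + 2"] by (auto simp: residue_5)
  ultimately obtain p q where pq: "E y (x p)" "E y (x q)" "p \<noteq> q"
    using residue_5_distinct[of k] by metis
  then have "{p, q} = {m - 1, m + 1}" using m[of p] m[of q] disjoint[of p] disjoint[of q] by auto
  then have y: "E y (x (m - 1))" "E y (x (m + 1))" using pq by (auto simp: doubleton_eq_iff)
  then have "E z (x j) \<longleftrightarrow> j \<noteq> m + 1 \<and> j \<noteq> m - 1" for j using m[of j] disjoint by blast
  moreover from this have "E y (x j) \<longleftrightarrow> j = m + 1 \<or> j = m - 1" for j using y disjoint by blast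
  ultimately show ?thesis using assms(1,2) unfolding arrangement_def by blast
qed

lemma arrangement_touches: "arrangement i z y \<Longrightarrow> touches y (i - 1) \<or> touches y (i + 1)"
  using u_neighbour_meets[of y "i + 2"] by (auto simp: arrangement_def residue_5)

lemma u_neighbour_bag_edges_linked:
  assumes "E u y" "E u y'" "b \<in> bag j" "c \<in> bag k" "E y b" "E y' c"
    and "k \<notin> {j + 1, j - 1}" "j \<notin> {l + 1, l - 1}" "k \<notin> {l + 1, l - 1}"
  shows "E y c \<or> E y' b \<or> E y (x l) \<or> E y' (x l)"
proof -
  have "\<not> E b c" "\<not> E v b" "\<not> E v c" "\<not> E (x l) b" "\<not> E (x l) c"
    using adjacent_bags_iff[OF assms(3,4)] x_bag_nonadjacent[OF assms(3,8)]
      x_bag_nonadjacent[OF assms(4,9)] assms(3,4,7) by (simp_all add: bag_def far_from_def)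
  moreover have "\<not> E v y" "\<not> E v y'" "\<not> E y y'" using uv assms(1,2) sym triangle_free by blast+
  ultimately show ?thesis
    using three_edges_linked[OF v_x[of l] assms(5,6)] by (auto simp: linked_def commute)
qed

lemma arrangements_nonadjacent:
  assumes "arrangement i z y" "arrangement j z' y'" "i \<noteq> j"
  shows "\<not> E z y'"
proof -
  have "E z (x (j + 1)) \<or> E z (x (j - 1))"
    by (cases j i rule: residue_5_cases)
      (use assms(1,3) in \<open>simp_all add: arrangement_def residue_5\<close>)
  moreover have "E y' (x (j + 1))" "E y' (x (j - 1))"
    using assms(2) by (simp_all add: arrangement_def)
  ultimately show ?thesis using triangle_free[of z y'] by blast
qed

lemma arrangements_shared_bag_neighbour:
  assumes "arrangement i z y" "arrangement j z' y'" "i \<noteq> j"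
    and "k \<notin> {i + 1, i - 1, j + 1, j - 1}" "l \<in> {i + 1, i - 1}" "l \<notin> {j + 1, j - 1}"
    and "l = k + 1 \<or> l = k - 1"
  shows "\<exists>b\<in>bag k. E (x l) b \<and> E y' b"
  using shared_bag_neighbour[of z k l y'] arrangements_nonadjacent[OF assms(1-3)] assms
  by (simp add: arrangement_def)

lemma no_arrangements_at_distance_1:
  assumes "arrangement i z y" "arrangement (i + 1) z' y'"
  shows False
proof -
  have y: "E u y" "E y (x j) \<longleftrightarrow> j = i + 1 \<or> j = i - 1"
    and y': "E u y'" "E y' (x j) \<longleftrightarrow> j = i + 2 \<or> j = i" for j
    using assms by (simp_all add: arrangement_def residue_5)
  obtain c where c: "c \<in> bag (i - 2)" "E (x (i - 1)) c" "E y' c"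
    using arrangements_shared_bag_neighbour[OF assms, of "i - 2" "i - 1"] by (auto simp: residue_5)
  obtain d where d: "d \<in> bag (i - 2)" "E y d"
    using arrangements_shared_bag_neighbour[OF assms(2,1), of "i - 2" "i + 2"]
    by (auto simp: residue_5)
  have "touches y (i - 2)" "touches y' (i - 2)" using c d unfolding touches_def by blast+
  then have "touches y (i + 1)" "\<not> touches y' (i + 1)"
    using arrangement_touches[OF assms(1)] arrangement_touches[OF assms(2)]
      not_touches_consecutive[of y "i - 2"] not_touches_consecutive[of y' "i + 2"]
      not_touches_consecutive[of y' i]
    by (auto simp: residue_5)
  then obtain b where b: "b \<in> bag (i + 1)" "E y b" "\<not> E y' b" unfolding touches_def by blast
  have "\<not> E y c" using triangle_free[of y "x (i - 1)" c] c(2) y(2) by simp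
  then show False
    using u_neighbour_bag_edges_linked[OF y(1) y'(1) b(1) c(1) b(2) c(3), of "i - 2"] b(3)
    by (simp add: y(2) y'(2) residue_5)
qed

lemma no_arrangements_at_distance_2:
  assumes "arrangement i z y" "arrangement (i + 2) z' y'"
  shows False
proof -
  have y: "E u y" "E y (x j) \<longleftrightarrow> j = i + 1 \<or> j = i - 1"
    and y': "E u y'" "E y' (x j) \<longleftrightarrow> j = i - 2 \<or> j = i + 1" for j
    using assms by (simp_all add: arrangement_def residue_5)
  obtain c where c: "c \<in> bag i" "E y' c"
    using arrangements_shared_bag_neighbour[OF assms, of i "i - 1"] by (auto simp: residue_5)
  obtain b where b: "b \<in> bag (i + 2)" "E y b"
    using arrangements_shared_bag_neighbour[OF assms(2,1), of "i + 2" "i - 2"]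
    by (auto simp: residue_5)
  have "touches y (i + 2)" "touches y' i" using b c unfolding touches_def by blast+
  then have "\<not> touches y i" "\<not> touches y' (i + 2)"
    using arrangement_touches[OF assms(1)] arrangement_touches[OF assms(2)]
      not_touches_consecutive[of y "i + 1"] not_touches_consecutive[of y "i - 1"]
      not_touches_consecutive[of y' i] not_touches_consecutive[of y' "i + 2"]
    by (auto simp: residue_5)
  then have "\<not> E y c" "\<not> E y' b" using b(1) c(1) unfolding touches_def by blast+
  then show False
    using u_neighbour_bag_edges_linked[OF y(1) y'(1) b(1) c(1) b(2) c(2), of i]
    by (simp add: y(2) y'(2) residue_5)
qed

lemma arrangement_unique:
  assumes "arrangement i z y" "arrangement j z' y'"
  shows "j = i"
proof (cases j i rule: residue_5_cases)
  case 2
  then show ?thesis using no_arrangements_at_distance_1 assms by blast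
next
  case 3
  then show ?thesis using no_arrangements_at_distance_2 assms by blast
next
  case 4
  then show ?thesis
    using no_arrangements_at_distance_2[OF assms(2)] assms(1) by (simp add: residue_5)
next
  case 5
  then show ?thesis
    using no_arrangements_at_distance_1[OF assms(2)] assms(1) by (simp add: residue_5)
qed

lemma ex_unattached_twin: "\<exists>i. \<forall>z. attached z \<longrightarrow> \<not> E z (x i)"
proof (rule ccontr)
  assume "\<not> ?thesis"
  then have arr: "\<exists>j z y. arrangement j z y \<and> E z (x i)" for i
    using ex_arrangement unfolding attached_def by metis
  obtain i z y where "arrangement i z y" using arr[of 0] by blast
  moreover obtain j z' y' where "arrangement j z' y'" and z': "E z' (x (i + 1))"
    using arr[of "i + 1"] by blast
  ultimately have "arrangement i z' y'" using arrangement_unique by blast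
  then show False using z' by (simp add: arrangement_def)
qed

end

context far_five_cycle
begin

lemma four_colourable: "colourable E UNIV 4"
proof (rule ccontr)
  assume "\<not> ?thesis"
  then obtain x where x: "\<And>i. obstructs (x i) i"
    using four_colourable_if_unobstructed by metis
  interpret five_cycle_with_twins E u v a x
    by unfold_locales (use x in \<open>simp_all add: obstructs_def\<close>)
  show False using ex_unattached_twin x unfolding obstructs_def by blast
qed

end

lemma (in triangle_free_graph) four_colourable_or_far_two_colourable:
  assumes "matching_free E UNIV 3"
  shows "colourable E UNIV 4 \<or> (\<forall>u v. E u v \<longrightarrow> colourable E {w. far_from E u v w} 2)"
proof (cases "\<exists>u v a. far_five_cycle E u v a")
  case True
  then obtain u v a where "far_five_cycle E u v a" by blast
  then show ?thesis by (intro disjI1 far_five_cycle.four_colourable)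
next
  case False
  have "colourable E {w. far_from E u v w} 2" if uv: "E u v" for u v
  proof (rule two_colourable_if_no_five_cycle)
    show "matching_free E {w. far_from E u v w} 2"
      using matching_free_far[of UNIV 2 u v] assms uv by (simp add: numeral_3_eq_3 numeral_2_eq_2)
    have "far_five_cycle E u v f" if "\<forall>i. f i \<in> {w. far_from E u v w} \<and> E (f i) (f (i + 1))" for f
      by unfold_locales (use assms uv that in simp_all)
    then show "\<not> (\<exists>f :: 5 \<Rightarrow> 'a. \<forall>i. f i \<in> {w. far_from E u v w} \<and> E (f i) (f (i + 1)))"
      using False by blast
  qed
  then show ?thesis by blast
qed

lemma (in adjacency) triangle_3K2_free_colourable:
  assumes "finite S" "cliques_le E S 2" "matching_free E S 3"
  shows "colourable E S 4"
proof -
  define F where "F = (\<lambda>x y. x \<in> S \<and> y \<in> S \<and> E x y)"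
  interpret F: triangle_free_graph F
  proof
    show "F x y \<Longrightarrow> F y x" for x y using sym by (simp add: F_def)
    show "F x y \<Longrightarrow> F y z \<Longrightarrow> \<not> F x z" for x y z
      using triangle_free_if_cliques_le_2[OF assms(2), of x y z] by (simp add: F_def)
  qed
  note restrict = colourable_restrict[where S = S and E = E, folded F_def]
  have "matching_free F UNIV 3"
    unfolding F_def by (rule matching_free_restrict[OF assms(3)])
  then consider "colourable F UNIV 4" | "\<And>u v. F u v \<Longrightarrow> colourable F {w. far_from F u v w} 2"
    using F.four_colourable_or_far_two_colourable by blast
  then show ?thesis
  proof cases
    case 1
    then show ?thesis using restrict colourable_subset by blast
  next
    case 2
    have "colourable E {w \<in> S. far_from E u v w} 2" if "u \<in> S" "v \<in> S" "E u v" for u v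
    proof (rule restrict)
      have "F u v" using that by (simp add: F_def)
      then show "colourable F {w \<in> S. far_from E u v w} 2"
        by (rule 2[THEN colourable_subset]) (auto simp: F_def far_from_def)
    qed blast
    then show ?thesis
      using colourable_if_far_colourable[OF assms(1) gem_free_if_cliques_le_2 assms(2), of 2]
        assms(2) by simp
  qed
qed

section \<open>The bound\<close>

lemma gem_bound_le_1: "m \<le> 1 \<Longrightarrow> gem_bound p m = m"
  by (subst gem_bound.simps) auto

lemma gem_bound_2: "m \<ge> 2 \<Longrightarrow> gem_bound 2 m = max 3 m"
  by (subst gem_bound.simps) auto

lemma gem_bound_Suc:
  assumes "p \<ge> 2" "m \<ge> 2" "p > 2 \<or> m > 2"
  shows "gem_bound (Suc p) m = gem_bound p m + 2 * (m - 1)"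
proof (cases "m = 2")
  case True
  then show ?thesis using assms gem_bound_eqs(4)[of p] gem_bound_eqs(4)[of "Suc p"] by simp
next
  case False
  then show ?thesis using assms gem_bound_eqs(5)[of "Suc p" m] by simp
qed

context adjacency
begin

lemma gem_bound_colourable_step:
  assumes "finite S" "gem_free E S" "cliques_le E S m" "matching_free E S (Suc p)"
    and "p \<ge> 2" "m \<ge> 2"
    and far: "\<And>u v. u \<in> S \<Longrightarrow> v \<in> S \<Longrightarrow> E u v \<Longrightarrow>
      colourable E {w \<in> S. far_from E u v w} (gem_bound p m)"
  shows "colourable E S (gem_bound (Suc p) m)"
proof (cases "p > 2 \<or> m > 2")
  case True
  show ?thesis
    unfolding gem_bound_Suc[OF assms(5,6) True]
    by (intro colourable_if_far_colourable assms(1-3,6) far)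
next
  case False
  then have pm: "Suc p = 3" "m = 2" using assms(5,6) by simp_all
  have "colourable E S 4"
    using triangle_3K2_free_colourable assms(1,3,4) unfolding pm by blast
  then show ?thesis using gem_bound_eqs(4)[of 3] unfolding pm by simp
qed

lemma gem_bound_colourable:
  assumes "p \<ge> 2" "finite S" "gem_free E S" "cliques_le E S m" "matching_free E S p"
  shows "colourable E S (gem_bound p m)"
proof (cases "m \<le> 1")
  case True
  then show ?thesis using colourable_if_cliques_le_1 assms(2,4) by (simp add: gem_bound_le_1)
next
  case False
  then have m: "m \<ge> 2" by simp
  show ?thesis
    using assms
  proof (induction p arbitrary: S rule: dec_induct)
    case base
    then show ?case using two_K2_gem_free_colourable m by (simp add: gem_bound_2)
  next
    case (step p)
    have "colourable E {w \<in> S. far_from E u v w} (gem_bound p m)"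
      if "u \<in> S" "v \<in> S" "E u v" for u v
      using step.prems that
      by (intro step.IH matching_free_far) (auto intro: gem_free_subset cliques_le_subset)
    then show ?case by (intro gem_bound_colourable_step step.prems step.hyps(1) m)
  qed
qed

end

section \<open>Excluded induced subgraphs\<close>

abbreviation adj :: "'a pair_pre_digraph \<Rightarrow> 'a \<Rightarrow> 'a \<Rightarrow> bool" where
  "adj G x y \<equiv> (x, y) \<in> parcs G"

definition induced_embedding :: "'b pair_pre_digraph \<Rightarrow> 'a pair_pre_digraph \<Rightarrow> ('b \<Rightarrow> 'a) \<Rightarrow> bool" where
  "induced_embedding F G h \<longleftrightarrow> inj_on h (pverts F) \<and> h ` pverts F \<subseteq> pverts G \<and>
     (\<forall>x\<in>pverts F. \<forall>y\<in>pverts F. adj G (h x) (h y) \<longleftrightarrow> adj F x y)"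

lemma not_family_free_if_induced_embedding:
  fixes h :: "'b \<Rightarrow> 'a"
  assumes "pair_graph G" "pair_graph F" "F \<in> \<F>" "induced_embedding F G h"
  shows "\<not> family_free \<F> G"
proof -
  interpret G: pair_graph G by fact
  interpret F: pair_graph F by fact
  have h: "inj_on h (pverts F)" "h ` pverts F \<subseteq> pverts G"
    and arcs: "\<And>x y. x \<in> pverts F \<Longrightarrow> y \<in> pverts F \<Longrightarrow> adj G (h x) (h y) \<longleftrightarrow> adj F x y"
    using assms(4) by (auto simp: induced_embedding_def)
  define iso :: "('b, 'b \<times> 'b, 'a, 'a \<times> 'a) digraph_isomorphism" where
    "iso = \<lparr>iso_verts = h, iso_arcs = map_prod h h, iso_head = snd, iso_tail = fst\<rparr>"
  define H where "H = app_iso iso (with_proj F)"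
  have F_arcs: "parcs F \<subseteq> pverts F \<times> pverts F"
    using F.in_arcsD1 F.in_arcsD2 by auto
  have iso: "F.digraph_isomorphism iso"
    unfolding F.digraph_isomorphism_def iso_def
    using h(1) F.wf_digraph_axioms
    by (auto intro: inj_on_subset[OF map_prod_inj_on[OF h(1) h(1)] F_arcs])
  then have "digraph_iso (with_proj F) H" unfolding digraph_iso_def H_def by blast
  then have "digraph_iso H (with_proj F)" by (rule digraph_iso_swap[OF F.wf_digraph_axioms])
  moreover have "induced_subgraph H (with_proj G)"
  proof -
    have "verts H = h ` pverts F" "tail H = fst" "head H = snd"
      by (simp_all add: H_def iso_def)
    moreover have "arcs H = {e \<in> parcs G. fst e \<in> h ` pverts F \<and> snd e \<in> h ` pverts F}"
      using arcs F_arcs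
      by (auto simp: H_def iso_def map_prod_def image_iff split: prod.splits) force+
    moreover have "wf_digraph H" unfolding H_def by (rule F.wf_digraphI_app_iso[OF iso])
    ultimately show ?thesis
      using h(2) G.wf_digraph_axioms
      by (auto simp: induced_subgraph_def subgraph_def compatible_def)
  qed
  ultimately show ?thesis using assms(3) unfolding family_free_def by blast
qed

lemma adj_pK2_iff:
  assumes "x < 2 * p" "y < 2 * p"
  shows "adj (pK2 p) x y \<longleftrightarrow> x div 2 = y div 2 \<and> x \<noteq> y"
proof
  assume "adj (pK2 p) x y"
  then show "x div 2 = y div 2 \<and> x \<noteq> y" by (auto simp: pK2_def)
next
  assume xy: "x div 2 = y div 2 \<and> x \<noteq> y"
  then have "(x, y) \<in> {(2 * (x div 2), 2 * (x div 2) + 1), (2 * (x div 2) + 1, 2 * (x div 2))}"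
    by simp presburger
  moreover have "x div 2 < p" using assms(1) by auto
  ultimately show "adj (pK2 p) x y" unfolding pK2_def by auto
qed

context pair_graph
begin

sublocale adj: adjacency "adj G"
  by unfold_locales (use arcs_symmetric no_loops' in blast)+

lemma gem_free_if_family_free:
  assumes "family_free \<F> G" "gem \<in> \<F>"
  shows "gem_free (adj G) (pverts G)"
proof (rule ccontr)
  assume "\<not> ?thesis"
  then obtain e a b c d where V: "{e, a, b, c, d} \<subseteq> pverts G"
    and centre: "adj G e a" "adj G e b" "adj G e c" "adj G e d"
    and path: "adj G a b" "adj G b c" "adj G c d"
    and chords: "\<not> adj G a c" "\<not> adj G a d" "\<not> adj G b d"
    unfolding gem_free_def path4_free_def by blast
  define h :: "nat \<Rightarrow> 'a" where "h = (\<lambda>_. e)(0 := a, 1 := b, 2 := c, 3 := d)"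
  have verts: "pverts gem = {0, 1, 2, 3, 4}" by (auto simp: gem_def)
  have symm: "adj G a e" "adj G b e" "adj G c e" "adj G d e" "adj G b a" "adj G c b" "adj G d c"
    "\<not> adj G c a" "\<not> adj G d a" "\<not> adj G d b"
    using centre path chords adj.commute by blast+
  have "distinct [a, b, c, d, e]"
    using centre path chords symm adj.irrefl by auto
  then have "induced_embedding gem G h"
    using V centre path chords symm adj.irrefl
    by (auto simp: induced_embedding_def verts h_def inj_on_def gem_def)
  then show False
    using not_family_free_if_induced_embedding[OF pair_graph_axioms pair_graph_gem] assms by blast
qed

lemma matching_free_if_family_free:
  assumes "family_free \<F> G" "pK2 p \<in> \<F>"
  shows "matching_free (adj G) (pverts G) p"
  unfolding matching_free_def
proof clarify
  fix f g
  assume edges: "\<forall>i<p. f i \<in> pverts G \<and> g i \<in> pverts G \<and> adj G (f i) (g i)"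
    and unlinked: "\<forall>i<p. \<forall>j<p. i \<noteq> j \<longrightarrow> \<not> linked (adj G) (f i) (g i) (f j) (g j)"
  define h where "h x = (if even x then f else g) (x div 2)" for x
  have adj_h: "adj G (h x) (h y) \<longleftrightarrow> x div 2 = y div 2 \<and> x \<noteq> y" if "x < 2 * p" "y < 2 * p" for x y
  proof (cases "x div 2 = y div 2")
    case True
    then have "even x = even y \<longleftrightarrow> x = y" by (metis bit_eq_rec)
    moreover have "adj G (f (x div 2)) (g (x div 2))" using edges that(1) by simp
    ultimately show ?thesis using True adj.irrefl adj.commute by (auto simp: h_def)
  next
    case False
    then have "\<not> linked (adj G) (f (x div 2)) (g (x div 2)) (f (y div 2)) (g (y div 2))"
      using unlinked that by simp
    then show ?thesis using False by (simp add: h_def linked_def)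
  qed
  have "inj_on h {..<2 * p}"
  proof (rule inj_onI, rule ccontr)
    fix x y assume xy: "x \<in> {..<2 * p}" "y \<in> {..<2 * p}" "h x = h y" "x \<noteq> y"
    define x' where "x' = (if even x then x + 1 else x - 1)"
    have "x' div 2 = x div 2" "x' \<noteq> x" "x' < 2 * p"
      using xy(1) by (auto simp: x'_def elim!: oddE)
    then show False
      using adj_h[of x x'] adj_h[of y x'] adj_h[of x y] xy adj.irrefl by auto
  qed
  then have "induced_embedding (pK2 p) G h"
    using edges adj_h adj_pK2_iff by (auto simp: induced_embedding_def pK2_def h_def)
  then show False
    using not_family_free_if_induced_embedding[OF pair_graph_axioms pair_graph_pK2] assms by blast
qed

lemma cliques_le_clique_number: "cliques_le (adj G) (pverts G) (clique_number G)"
proof -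
  have "finite {S. clique G S}"
    by (rule finite_subset[of _ "Pow (pverts G)"])
      (use pair_finite_verts in \<open>auto simp: clique_def\<close>)
  then show ?thesis
    unfolding cliques_le_def clique_number_def clique_def by (auto intro!: Max_ge)
qed

lemma chromatic_number_le:
  assumes "colourable (adj G) (pverts G) k"
  shows "chromatic_number G \<le> k"
proof -
  obtain c where "proper_colouring G k c"
    using assms in_arcsD1 in_arcsD2 unfolding colourable_def proper_colouring_def by fast
  then show ?thesis unfolding chromatic_number_def by (intro Least_le) blast
qed

end

theorem theorem3p3:
  fixes G :: "'a pair_pre_digraph" and p :: nat
  assumes "p \<ge> 2"
    and "pair_graph G"
    and "family_free {pK2 p, gem} G"
  shows "chromatic_number G \<le> gem_bound p (clique_number G)"
proof -
  interpret pair_graph G by fact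
  have "gem_free (adj G) (pverts G)" using assms(3) by (rule gem_free_if_family_free) simp
  moreover have "matching_free (adj G) (pverts G) p"
    using assms(3) by (rule matching_free_if_family_free) simp
  ultimately have "colourable (adj G) (pverts G) (gem_bound p (clique_number G))"
    by (intro adj.gem_bound_colourable assms(1) pair_finite_verts cliques_le_clique_number)
  then show ?thesis by (rule chromatic_number_le)
qed

end
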